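(* Let $\mathfrak{g}$ be a finite-dimensional complex Lie algebra, $\theta:\mathfrak{g}\times\mathfrak{g}\to\mathfrak{g}^*$ a 2-cocycle of $\mathfrak{g}$, and $(\mathfrak{h},B_{\mathfrak{h}})$ a finite-dimensional complex symplectic vector space with symplectic form $B_{\mathfrak{h}}$. Let $\psi:\mathfrak{g}\to\mathrm{End}(\mathfrak{h})$ be a Lie algebra homomorphism satisfying $B_{\mathfrak{h}}(\psi(X)(Y),Z)=-B_{\mathfrak{h}}(Y,\psi(X)(Z))$ for all $X\in\mathfrak{g}$, $Y,Z\in\mathfrak{h}$. Let $\phi:\mathfrak{h}\times\mathfrak{h}\to\mathfrak{g}^*$ be the bilinear map defined by $\phi(X,Y)Z=B_{\mathfrak{h}}(\psi(Z)(X),Y)$ for all $X,Y\in\mathfrak{h}$, $Z\in\mathfrak{g}$, and define on the vector space $\overline{\mathfrak{g}}:=\mathfrak{g}\oplus\mathfrak{g}^*\oplus\mathfrak{h}$ the bracket $$[X+f+F,Y+g+G]=[X,Y]_{\mathfrak{g}}+\mathrm{ad}^*(X)(g)-\mathrm{ad}^*(Y)(f)+\theta(X,Y)+\psi(X)(G)-\psi(Y)(F)+\phi(F,G)$$ for all $X,Y\in\mathfrak{g}$, $f,g\in\mathfrak{g}^*$, $F,G\in\mathfrak{h}$. Then $\overline{\mathfrak{g}}$ is a Lie superalgebra with even part $\overline{\mathfrak{g}}_{\overline{0}}=\mathfrak{g}\oplus\mathfrak{g}^*$ and odd part $\overline{\mathfrak{g}}_{\overline{1}}=\mathfrak{h}$.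 Moreover, if $\theta$ is cyclic, then $\overline{\mathfrak{g}}$ is a quadratic Lie superalgebra with the bilinear form $$\overline{B}(X+f+F,Y+g+G)=f(Y)+g(X)+B_{\mathfrak{h}}(F,G)$$ for all $X,Y\in\mathfrak{g}$, $f,g\in\mathfrak{g}^*$, $F,G\in\mathfrak{h}$.
   Context: All vector spaces are finite-dimensional over $\mathbb{C}$. The coadjoint representation is $\mathrm{ad}^*(X)(f)=-f\circ\mathrm{ad}(X)$. A 2-cocycle of $\mathfrak{g}$ is a skew-symmetric bilinear map $\theta:\mathfrak{g}\times\mathfrak{g}\to\mathfrak{g}^*$ such that the sum over cyclic permutations of $(X,Y,Z)$ of $\theta(X,Y)\circ\mathrm{ad}(Z)+\theta([X,Y],Z)$ is zero for all $X,Y,Z\in\mathfrak{g}$. It is cyclic if $\theta(X,Y)Z=\theta(Y,Z)X$ for all $X,Y,Z\in\mathfrak{g}$. A quadratic Lie superalgebra is a Lie superalgebra $\mathfrak{g}=\mathfrak{g}_{\overline 0}\oplus\mathfrak{g}_{\overline 1}$ with a non-degenerate bilinear form $B$ that is supersymmetric ($B(Y,X)=(-1)^{xy}B(X,Y)$ for $X\in\mathfrak{g}_x$, $Y\in\mathfrak{g}_y$), invariant ($B([X,Y],Z)=B(X,[Y,Z])$), and even ($B(\mathfrak{g}_{\overline 0},\mathfrak{g}_{\overline 1})=0$). *)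

theory Defs
  imports Complex_Main "HOL-Library.Function_Algebras" "HOL-Library.Product_Plus" "HOL-Library.Z2"
begin

text \<open>
  Vector spaces are given by a scalar multiplication of the complex numbers on an abelian group
  type. The input data (the Lie algebra and the symplectic space) occupy whole types, whereas the
  dual space is a proper subspace of a function type; superalgebras therefore live on a
  subspace of an ambient vector space, and their axioms are relativised to it.
\<close>

definition fin_dim_subspace :: "(complex \<Rightarrow> 'a::ab_group_add \<Rightarrow> 'a) \<Rightarrow> 'a set \<Rightarrow> bool" where
  "fin_dim_subspace s V \<longleftrightarrow>
     vector_space s \<and> module.subspace s V \<and> (\<exists>S. finite S \<and> module.span s S = V)"

definition bilinear_on ::
  "(complex \<Rightarrow> 'a::ab_group_add \<Rightarrow> 'a) \<Rightarrow> (complex \<Rightarrow> 'b::ab_group_add \<Rightarrow> 'b) \<Rightarrow>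
   'a set \<Rightarrow> ('a \<Rightarrow> 'a \<Rightarrow> 'b) \<Rightarrow> bool" where
  "bilinear_on s t V b \<longleftrightarrow>
     (\<forall>x\<in>V. \<forall>y\<in>V. \<forall>z\<in>V. b (x + y) z = b x z + b y z \<and> b z (x + y) = b z x + b z y) \<and>
     (\<forall>c. \<forall>x\<in>V. \<forall>z\<in>V. b (s c x) z = t c (b x z) \<and> b z (s c x) = t c (b z x))"

definition nondegenerate_on :: "'a::zero set \<Rightarrow> ('a \<Rightarrow> 'a \<Rightarrow> complex) \<Rightarrow> bool" where
  "nondegenerate_on V b \<longleftrightarrow>
     (\<forall>x\<in>V. (\<forall>y\<in>V. b x y = 0) \<longrightarrow> x = 0) \<and> (\<forall>y\<in>V. (\<forall>x\<in>V. b x y = 0) \<longrightarrow> y = 0)"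

definition fun_scale :: "(complex \<Rightarrow> 'b \<Rightarrow> 'b) \<Rightarrow> complex \<Rightarrow> ('a \<Rightarrow> 'b) \<Rightarrow> 'a \<Rightarrow> 'b" where
  "fun_scale t c f = (\<lambda>x. t c (f x))"

definition dual_space :: "(complex \<Rightarrow> 'a::ab_group_add \<Rightarrow> 'a) \<Rightarrow> ('a \<Rightarrow> complex) set" where
  "dual_space s = {f. Vector_Spaces.linear s (*) f}"


locale lie_algebra =
  fixes scale :: "complex \<Rightarrow> 'a::ab_group_add \<Rightarrow> 'a"
    and br :: "'a \<Rightarrow> 'a \<Rightarrow> 'a"
  assumes fin_dim: "fin_dim_subspace scale UNIV"
    and bilinear: "bilinear_on scale scale UNIV br"
    and alternating: "br X X = 0"
    and jacobi: "br X (br Y Z) + br Y (br Z X) + br Z (br X Y) = 0"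

text \<open>For a Lie algebra bracket, \<open>ad X\<close> is the partially applied bracket \<open>br X\<close>.\<close>

definition coad :: "('a \<Rightarrow> 'a \<Rightarrow> 'a) \<Rightarrow> 'a \<Rightarrow> ('a \<Rightarrow> complex) \<Rightarrow> 'a \<Rightarrow> complex" where
  "coad br X f = - (f \<circ> br X)"

definition two_cocycle ::
  "(complex \<Rightarrow> 'a::ab_group_add \<Rightarrow> 'a) \<Rightarrow> ('a \<Rightarrow> 'a \<Rightarrow> 'a) \<Rightarrow> ('a \<Rightarrow> 'a \<Rightarrow> 'a \<Rightarrow> complex) \<Rightarrow> bool"
  where
  "two_cocycle s br \<theta> \<longleftrightarrow>
     (\<forall>X Y. \<theta> X Y \<in> dual_space s) \<and>
     bilinear_on s (fun_scale (*)) UNIV \<theta> \<and>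
     (\<forall>X Y. \<theta> Y X = - \<theta> X Y) \<and>
     (\<forall>X Y Z.
        (\<theta> X Y \<circ> br Z) + \<theta> (br X Y) Z +
        (\<theta> Y Z \<circ> br X) + \<theta> (br Y Z) X +
        (\<theta> Z X \<circ> br Y) + \<theta> (br Z X) Y = 0)"

definition cyclic :: "('a \<Rightarrow> 'a \<Rightarrow> 'a \<Rightarrow> complex) \<Rightarrow> bool" where
  "cyclic \<theta> \<longleftrightarrow> (\<forall>X Y Z. \<theta> X Y Z = \<theta> Y Z X)"

locale symplectic_space =
  fixes scale :: "complex \<Rightarrow> 'h::ab_group_add \<Rightarrow> 'h"
    and B :: "'h \<Rightarrow> 'h \<Rightarrow> complex"
  assumes fin_dim: "fin_dim_subspace scale UNIV"
    and bilinear: "bilinear_on scale (*) UNIV B"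
    and skew: "B Y X = - B X Y"
    and nondegenerate: "nondegenerate_on UNIV B"

text \<open>A homomorphism of Lie algebras into the endomorphisms with the commutator bracket.\<close>

definition lie_hom_End ::
  "(complex \<Rightarrow> 'a::ab_group_add \<Rightarrow> 'a) \<Rightarrow> ('a \<Rightarrow> 'a \<Rightarrow> 'a) \<Rightarrow>
   (complex \<Rightarrow> 'h::ab_group_add \<Rightarrow> 'h) \<Rightarrow> ('a \<Rightarrow> 'h \<Rightarrow> 'h) \<Rightarrow> bool" where
  "lie_hom_End s br t \<psi> \<longleftrightarrow>
     (\<forall>X. Vector_Spaces.linear t t (\<psi> X)) \<and>
     Vector_Spaces.linear s (fun_scale t) \<psi> \<and>
     (\<forall>X Y. \<psi> (br X Y) = (\<psi> X \<circ> \<psi> Y) - (\<psi> Y \<circ> \<psi> X))"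


text \<open>
  Parities are elements of the two-element field \<open>bit\<close>; \<open>koszul i j\<close> is the sign $(-1)^{ij}$.
\<close>

definition koszul :: "bit \<Rightarrow> bit \<Rightarrow> complex" where
  "koszul i j = (if i * j = 1 then - 1 else 1)"

text \<open>
  \<open>L\<close> is the underlying space and \<open>V i\<close> its homogeneous part of parity \<open>i\<close>. Closure of \<open>L\<close> under the
  bracket follows from \<open>graded\<close>, \<open>decomposition\<close> and \<open>bilinear\<close>.
\<close>

locale lie_superalgebra =
  fixes scale :: "complex \<Rightarrow> 'a::ab_group_add \<Rightarrow> 'a"
    and L :: "'a set"
    and V :: "bit \<Rightarrow> 'a set"
    and br :: "'a \<Rightarrow> 'a \<Rightarrow> 'a"
  assumes fin_dim: "fin_dim_subspace scale L"
    and homogeneous: "module.subspace scale (V i)"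
    and decomposition: "L = {x + y | x y. x \<in> V 0 \<and> y \<in> V 1}" "V 0 \<inter> V 1 = {0}"
    and bilinear: "bilinear_on scale scale L br"
    and graded: "\<lbrakk>X \<in> V i; Y \<in> V j\<rbrakk> \<Longrightarrow> br X Y \<in> V (i + j)"
    and super_skew: "\<lbrakk>X \<in> V i; Y \<in> V j\<rbrakk> \<Longrightarrow> br Y X = - scale (koszul i j) (br X Y)"
    and super_jacobi: "\<lbrakk>X \<in> V i; Y \<in> V j; Z \<in> V k\<rbrakk> \<Longrightarrow>
      br X (br Y Z) = br (br X Y) Z + scale (koszul i j) (br Y (br X Z))"

locale quadratic_lie_superalgebra = lie_superalgebra scale L V br
  for scale :: "complex \<Rightarrow> 'a::ab_group_add \<Rightarrow> 'a" and L V br +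
  fixes B :: "'a \<Rightarrow> 'a \<Rightarrow> complex"
  assumes form_bilinear: "bilinear_on scale (*) L B"
    and form_nondegenerate: "nondegenerate_on L B"
    and form_supersymmetric: "\<lbrakk>X \<in> V i; Y \<in> V j\<rbrakk> \<Longrightarrow> B Y X = koszul i j * B X Y"
    and form_invariant: "\<lbrakk>X \<in> L; Y \<in> L; Z \<in> L\<rbrakk> \<Longrightarrow> B (br X Y) Z = B X (br Y Z)"
    and form_even: "\<lbrakk>X \<in> V 0; Y \<in> V 1\<rbrakk> \<Longrightarrow> B X Y = 0"


text \<open>
  The triple \<open>(X, f, F)\<close> stands for $X + f + F$ in the direct sum of the Lie algebra, its dual
  and the symplectic space.
\<close>

definition ext_space ::
  "(complex \<Rightarrow> 'g::ab_group_add \<Rightarrow> 'g) \<Rightarrow> ('g \<times> ('g \<Rightarrow> complex) \<times> 'h) set" where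
  "ext_space s = UNIV \<times> dual_space s \<times> UNIV"

definition ext_even ::
  "(complex \<Rightarrow> 'g::ab_group_add \<Rightarrow> 'g) \<Rightarrow> ('g \<times> ('g \<Rightarrow> complex) \<times> 'h::zero) set" where
  "ext_even s = UNIV \<times> dual_space s \<times> {0}"

definition ext_odd :: "('g::zero \<times> ('g \<Rightarrow> complex) \<times> 'h) set" where
  "ext_odd = {0} \<times> {0} \<times> UNIV"

fun ext_scale ::
  "(complex \<Rightarrow> 'g \<Rightarrow> 'g) \<Rightarrow> (complex \<Rightarrow> 'h \<Rightarrow> 'h) \<Rightarrow>
   complex \<Rightarrow> 'g \<times> ('g \<Rightarrow> complex) \<times> 'h \<Rightarrow> 'g \<times> ('g \<Rightarrow> complex) \<times> 'h" where
  "ext_scale s t c (X, f, F) = (s c X, fun_scale (*) c f, t c F)"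

fun ext_bracket ::
  "('g \<Rightarrow> 'g \<Rightarrow> 'g) \<Rightarrow> ('g \<Rightarrow> 'g \<Rightarrow> 'g \<Rightarrow> complex) \<Rightarrow>
   ('g \<Rightarrow> 'h::ab_group_add \<Rightarrow> 'h) \<Rightarrow> ('h \<Rightarrow> 'h \<Rightarrow> 'g \<Rightarrow> complex) \<Rightarrow>
   'g \<times> ('g \<Rightarrow> complex) \<times> 'h \<Rightarrow> 'g \<times> ('g \<Rightarrow> complex) \<times> 'h \<Rightarrow> 'g \<times> ('g \<Rightarrow> complex) \<times> 'h" where
  "ext_bracket br \<theta> \<psi> \<phi> (X, f, F) (Y, g, G) =
     (br X Y,
      coad br X g - coad br Y f + \<theta> X Y + \<phi> F G,
      \<psi> X G - \<psi> Y F)"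

fun ext_form ::
  "('h \<Rightarrow> 'h \<Rightarrow> complex) \<Rightarrow>
   'g \<times> ('g \<Rightarrow> complex) \<times> 'h \<Rightarrow> 'g \<times> ('g \<Rightarrow> complex) \<times> 'h \<Rightarrow> complex" where
  "ext_form B (X, f, F) (Y, g, G) = f Y + g X + B F G"

end

theory Submission
  imports Defs
begin

text \<open>
  The super Jacobi identity splits by parity. On three even elements it combines the
  Jacobi identity, the fact that \<open>coad\<close> is a representation, and the cocycle identity. With
  one odd element it says that \<open>\<psi>\<close> is a representation, and with two odd elements that \<open>\<phi>\<close> is
  equivariant, which the skewness of \<open>\<psi>\<close> reduces to the same fact; with three odd elements
  every term vanishes. The form is invariant because cyclicity of \<open>\<theta>\<close> matches the
  \<open>\<theta>\<close>-terms, while the terms with \<open>\<phi>\<close> match by the definition of \<open>\<phi>\<close>.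
\<close>

section \<open>Linear algebra\<close>

text \<open>With one argument fixed, each partial map is additive, which yields the rules for
  differences, negatives and zero. Instances of these rules expand every bilinear map below.\<close>

lemma bilinear_on_UNIV:
  fixes s :: "complex \<Rightarrow> 'a::ab_group_add \<Rightarrow> 'a" and t :: "complex \<Rightarrow> 'b::ab_group_add \<Rightarrow> 'b"
  assumes "bilinear_on s t UNIV b"
  shows "b (x + y) z = b x z + b y z" "b z (x + y) = b z x + b z y"
    "b (s c x) z = t c (b x z)" "b z (s c x) = t c (b z x)"
    "b (x - y) z = b x z - b y z" "b z (x - y) = b z x - b z y"
    "b (- x) z = - b x z" "b z (- x) = - b z x"
    "b 0 z = 0" "b z 0 = 0"
proof -
  have l: "b (x + y) z = b x z + b y z" and r: "b z (x + y) = b z x + b z y" for x y z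
    using assms by (simp_all add: bilinear_on_def)
  interpret l: additive "\<lambda>x. b x z" by unfold_locales (rule l)
  interpret r: additive "b z" by unfold_locales (rule r)
  show "b (x + y) z = b x z + b y z" "b z (x + y) = b z x + b z y"
    "b (s c x) z = t c (b x z)" "b z (s c x) = t c (b z x)"
    "b (x - y) z = b x z - b y z" "b z (x - y) = b z x - b z y"
    "b (- x) z = - b x z" "b z (- x) = - b z x"
    "b 0 z = 0" "b z 0 = 0"
    using assms l.add l.diff l.minus l.zero r.add r.diff r.minus r.zero
    by (simp_all add: bilinear_on_def)
qed

lemma linear_simps:
  assumes "Vector_Spaces.linear s t f"
  shows "f (x + y) = f x + f y" "f (s c x) = t c (f x)" "f (x - y) = f x - f y"
    "f (- x) = - f x" "f 0 = 0"
proof -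
  interpret Vector_Spaces.linear s t f by fact
  show "f (x + y) = f x + f y" "f (s c x) = t c (f x)" "f (x - y) = f x - f y"
    "f (- x) = - f x" "f 0 = 0"
    by (fact add scale diff neg zero)+
qed

section \<open>Vector space structures on function spaces and on the direct sum\<close>

lemma vector_space_complex: "vector_space ((*) :: complex \<Rightarrow> complex \<Rightarrow> complex)"
  by unfold_locales (simp_all add: algebra_simps)

lemma fun_scale_apply [simp]: "fun_scale t c f x = t c (f x)"
  by (simp add: fun_scale_def)

lemma vector_space_fun_scale:
  assumes "vector_space t"
  shows "vector_space (fun_scale t)"
proof -
  interpret vector_space t by fact
  show ?thesis
    by unfold_locales (simp_all add: fun_eq_iff scale_right_distrib scale_left_distrib)
qed

lemma vector_space_ext_scale:
  assumes "vector_space s" "vector_space t"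
  shows "vector_space (ext_scale s t)"
proof -
  interpret s: vector_space s by fact
  interpret t: vector_space t by fact
  interpret f: vector_space "fun_scale (*) :: complex \<Rightarrow> ('a \<Rightarrow> complex) \<Rightarrow> 'a \<Rightarrow> complex"
    by (intro vector_space_fun_scale vector_space_complex)
  show ?thesis
    by unfold_locales
      (auto simp: s.scale_right_distrib s.scale_left_distrib t.scale_right_distrib
        t.scale_left_distrib f.scale_right_distrib f.scale_left_distrib)
qed

section \<open>The dual space\<close>

lemma dual_space_iff:
  assumes "vector_space s"
  shows "f \<in> dual_space s \<longleftrightarrow> (\<forall>x y. f (x + y) = f x + f y) \<and> (\<forall>c x. f (s c x) = c * f x)"
  using assms vector_space_complex
  by (simp add: dual_space_def Vector_Spaces.linear_iff)

lemma subspace_dual_space: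
  assumes "vector_space s"
  shows "module.subspace (fun_scale (*)) (dual_space s)"
proof -
  interpret f: vector_space "fun_scale (*) :: complex \<Rightarrow> ('a \<Rightarrow> complex) \<Rightarrow> 'a \<Rightarrow> complex"
    by (intro vector_space_fun_scale vector_space_complex)
  show ?thesis
    by (rule f.subspaceI) (simp_all add: dual_space_iff[OF assms] algebra_simps)
qed

text \<open>A nonzero vector forms an independent set, so the value 1 on it extends to a linear
  functional. This later gives nondegeneracy of the pairing with the dual.\<close>

lemma dual_space_separates:
  assumes "vector_space s" and "x \<noteq> 0"
  obtains f where "f \<in> dual_space s" "f x \<noteq> 0"
proof -
  interpret vector_space_pair s "(*) :: complex \<Rightarrow> complex \<Rightarrow> complex"
    using assms(1) vector_space_complex by (rule vector_space_pair.intro)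
  have "vs1.independent {x}"
    using assms(2) by simp
  from linear_independent_extend[OF this, of "\<lambda>_. 1"]
  obtain f where "Vector_Spaces.linear s (*) f" "f x = 1"
    by auto
  then show thesis
    by (intro that[of f]) (simp_all add: dual_space_def)
qed

text \<open>A basis \<open>E\<close> taken from a finite spanning set has a dual basis of coordinate
  functionals, and every functional \<open>g\<close> is the sum of the \<open>d e\<close> with
  coefficients \<open>g e\<close>.\<close>

lemma fin_dim_subspace_dual_space:
  fixes s :: "complex \<Rightarrow> 'a::ab_group_add \<Rightarrow> 'a"
  assumes "fin_dim_subspace s UNIV"
  shows "fin_dim_subspace (fun_scale (*)) (dual_space s)"
proof -
  from assms obtain S where vs: "vector_space s" and S: "finite S" "module.span s S = UNIV"
    by (auto simp: fin_dim_subspace_def)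
  interpret vector_space_pair s "(*) :: complex \<Rightarrow> complex \<Rightarrow> complex"
    using vs vector_space_complex by (rule vector_space_pair.intro)
  interpret f: vector_space "fun_scale (*) :: complex \<Rightarrow> ('a \<Rightarrow> complex) \<Rightarrow> 'a \<Rightarrow> complex"
    by (intro vector_space_fun_scale vector_space_complex)
  obtain E where E: "E \<subseteq> S" "vs1.independent E" "S \<subseteq> vs1.span E"
    using vs1.maximal_independent_subset[of S] by blast
  have span_E: "vs1.span E = UNIV"
    using S(2) vs1.span_minimal[OF E(3) vs1.subspace_span] by auto
  have fin_E: "finite E"
    using E(1) S(1) by (rule finite_subset)
  \<comment> \<open>\<open>d e\<close> is the coordinate functional of \<open>e\<close>: it is
    prescribed on the basis and extended linearly.\<close>
  define d where "d e = construct E (\<lambda>e'. if e' = e then 1 else 0)" for e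
  have d_lin: "Vector_Spaces.linear s (*) (d e)" for e
    unfolding d_def by (rule linear_construct[OF E(2)])
  have d_E: "d e e' = (if e' = e then 1 else 0)" if "e' \<in> E" for e e'
    unfolding d_def by (rule construct_basis[OF E(2) that])
  have "f.span (d ` E) = dual_space s"
  proof
    show "f.span (d ` E) \<subseteq> dual_space s"
      using subspace_dual_space[OF vs] d_lin
      by (intro f.span_minimal) (auto simp: dual_space_def)
    show "dual_space s \<subseteq> f.span (d ` E)"
    proof
      fix g assume g: "g \<in> dual_space s"
      let ?h = "\<Sum>e\<in>E. fun_scale (*) (g e) (d e)"
      have h_span: "?h \<in> f.span (d ` E)"
        by (intro f.span_sum f.span_scale f.span_base imageI)
      then have "?h \<in> dual_space s"
        using \<open>f.span (d ` E) \<subseteq> dual_space s\<close> by blast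
      \<comment> \<open>Evaluation at a point commutes with the sum; an arbitrary index set
        \<open>A\<close> makes induction possible.\<close>
      have sum_apply: "(\<Sum>e\<in>A. fun_scale (*) (g e) (d e)) x = (\<Sum>e\<in>A. g e * d e x)" for A x
        by (induction A rule: infinite_finite_induct) simp_all
      have "g x = ?h x" for x
      proof (rule linear_eq_on)
        show "Vector_Spaces.linear s (*) g" "Vector_Spaces.linear s (*) ?h"
          using g \<open>?h \<in> dual_space s\<close> by (simp_all add: dual_space_def)
        show "x \<in> vs1.span E" by (simp add: span_E)
        show "g e = ?h e" if "e \<in> E" for e
        proof -
          have "(\<Sum>e'\<in>E. g e' * d e' e) = (\<Sum>e'\<in>E. if e = e' then g e' else 0)"
            using that by (intro sum.cong) (simp_all add: d_E)
          then show ?thesis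
            using that fin_E by (simp add: sum_apply)
        qed
      qed
      then have "g = ?h" by (rule ext)
      then show "g \<in> f.span (d ` E)" by (rule ssubst) (rule h_span)
    qed
  qed
  then show ?thesis
    unfolding fin_dim_subspace_def
    using f.vector_space_axioms subspace_dual_space[OF vs] fin_E by blast
qed

section \<open>Finite dimension of the direct sum\<close>

lemma fin_dim_subspace_ext_space:
  fixes s :: "complex \<Rightarrow> 'a::ab_group_add \<Rightarrow> 'a" and t :: "complex \<Rightarrow> 'h::ab_group_add \<Rightarrow> 'h"
  assumes "fin_dim_subspace s UNIV" "fin_dim_subspace t UNIV"
  shows "fin_dim_subspace (ext_scale s t) (ext_space s)"
proof -
  interpret s: vector_space s using assms(1) by (simp add: fin_dim_subspace_def)
  interpret t: vector_space t using assms(2) by (simp add: fin_dim_subspace_def)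
  interpret f: vector_space "fun_scale (*) :: complex \<Rightarrow> ('a \<Rightarrow> complex) \<Rightarrow> 'a \<Rightarrow> complex"
    by (intro vector_space_fun_scale vector_space_complex)
  interpret e: vector_space "ext_scale s t"
    by (intro vector_space_ext_scale s.vector_space_axioms t.vector_space_axioms)
  obtain S T D where S: "finite S" "s.span S = UNIV" and T: "finite T" "t.span T = UNIV"
    and D: "finite D" "f.span D = dual_space s"
    using assms fin_dim_subspace_dual_space[OF assms(1)] by (auto simp: fin_dim_subspace_def)
  have sub: "e.subspace (ext_space s)"
    using subspace_dual_space[OF s.vector_space_axioms]
    by (intro e.subspaceI) (auto simp: ext_space_def zero_prod_def f.subspace_def)
  \<comment> \<open>The three inclusions are linear, so the span of the image of a spanning set is
    the whole image of the corresponding summand.\<close>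
  interpret i1: module_hom s "ext_scale s t" "\<lambda>X. (X, 0, 0)"
    by unfold_locales (simp_all add: fun_eq_iff)
  interpret i2: module_hom "fun_scale (*)" "ext_scale s t" "\<lambda>f. (0, f, 0)"
    by unfold_locales simp_all
  interpret i3: module_hom t "ext_scale s t" "\<lambda>F. (0, 0, F)"
    by unfold_locales (simp_all add: fun_eq_iff)
  let ?G = "(\<lambda>X. (X, 0, 0)) ` S \<union> (\<lambda>f. (0, f, 0)) ` D \<union> (\<lambda>F. (0, 0, F)) ` T"
  have span_G: "e.span ?G = ext_space s"
  proof
    have "D \<subseteq> dual_space s"
      using f.span_superset[of D] D(2) by simp
    moreover have "0 \<in> dual_space s"
      by (simp add: dual_space_iff[OF s.vector_space_axioms])
    ultimately show "e.span ?G \<subseteq> ext_space s"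
      by (intro e.span_minimal sub) (auto simp: ext_space_def)
    show "ext_space s \<subseteq> e.span ?G"
    proof
      fix v :: "'a \<times> ('a \<Rightarrow> complex) \<times> 'h" assume "v \<in> ext_space s"
      then obtain X g F where v: "v = (X, g, F)" "g \<in> dual_space s"
        by (auto simp: ext_space_def)
      have "(X, 0, 0) \<in> e.span ((\<lambda>X. (X, 0, 0)) ` S)"
        using S(2) by (simp add: i1.span_image)
      then have 1: "(X, 0, 0) \<in> e.span ?G"
        by (rule subsetD[OF e.span_mono, rotated]) (intro Un_upper1 le_supI1)
      have "(0, g, 0) \<in> e.span ((\<lambda>f. (0, f, 0)) ` D)"
        using v(2) D(2) by (simp add: i2.span_image)
      then have 2: "(0, g, 0) \<in> e.span ?G"
        by (rule subsetD[OF e.span_mono, rotated]) (intro Un_upper2 le_supI1)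
      have "(0, 0, F) \<in> e.span ((\<lambda>F. (0, 0, F)) ` T)"
        using T(2) by (simp add: i3.span_image)
      then have 3: "(0, 0, F) \<in> e.span ?G"
        by (rule subsetD[OF e.span_mono, rotated]) (rule Un_upper2)
      have "(X, 0, 0) + (0, g, 0) + (0, 0, F) \<in> e.span ?G"
        by (intro e.span_add 1 2 3)
      then show "v \<in> e.span ?G"
        by (simp add: v)
    qed
  qed
  have "finite ?G"
    using S(1) D(1) T(1) by simp
  with e.vector_space_axioms sub span_G show ?thesis
    unfolding fin_dim_subspace_def by (intro conjI exI[of _ ?G])
qed

section \<open>The extension\<close>

text \<open>\<open>\<phi>\<close> is a parameter characterised by its values, so the results apply
  to the map given in the theorem.\<close>

locale ext_data =
  g: lie_algebra scale_g br + h: symplectic_space scale_h B_h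
  for scale_g :: "complex \<Rightarrow> 'g::ab_group_add \<Rightarrow> 'g" and br :: "'g \<Rightarrow> 'g \<Rightarrow> 'g"
    and scale_h :: "complex \<Rightarrow> 'h::ab_group_add \<Rightarrow> 'h" and B_h :: "'h \<Rightarrow> 'h \<Rightarrow> complex" +
  fixes \<theta> :: "'g \<Rightarrow> 'g \<Rightarrow> 'g \<Rightarrow> complex"
    and \<psi> :: "'g \<Rightarrow> 'h \<Rightarrow> 'h"
    and \<phi> :: "'h \<Rightarrow> 'h \<Rightarrow> 'g \<Rightarrow> complex"
  assumes cocycle: "two_cocycle scale_g br \<theta>"
    and hom: "lie_hom_End scale_g br scale_h \<psi>"
    and \<psi>_skew: "B_h (\<psi> X F) G = - B_h F (\<psi> X G)"
    and \<phi>_apply: "\<phi> F G Z = B_h (\<psi> Z F) G"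
begin

text \<open>Written as a lambda abstraction so that it expands to exactly the grading that the
  theorem mentions.\<close>

abbreviation "parity_part \<equiv> \<lambda>i::bit. if i = 0 then ext_even scale_g else ext_odd"

lemma vector_space_g: "vector_space scale_g" and vector_space_h: "vector_space scale_h"
  using g.fin_dim h.fin_dim by (simp_all add: fin_dim_subspace_def)

interpretation vg: vector_space scale_g by (rule vector_space_g)
interpretation vh: vector_space scale_h by (rule vector_space_h)
interpretation ve: vector_space "ext_scale scale_g scale_h"
  by (intro vector_space_ext_scale vector_space_g vector_space_h)

section \<open>Calculation rules for the given data\<close>

lemmas br_simps = bilinear_on_UNIV[OF g.bilinear]
lemmas B_simps = bilinear_on_UNIV[OF h.bilinear]

lemma \<theta>_dual: "\<theta> X Y \<in> dual_space scale_g"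
  and \<theta>_bilinear: "bilinear_on scale_g (fun_scale (*)) UNIV \<theta>"
  and \<theta>_skew: "\<theta> Y X = - \<theta> X Y"
  using cocycle unfolding two_cocycle_def by blast+

lemma \<theta>_cocycle:
  "\<theta> X Y (br Z W) + \<theta> (br X Y) Z W + \<theta> Y Z (br X W) + \<theta> (br Y Z) X W
    + \<theta> Z X (br Y W) + \<theta> (br Z X) Y W = 0"
proof -
  have "(\<theta> X Y \<circ> br Z) + \<theta> (br X Y) Z + (\<theta> Y Z \<circ> br X) + \<theta> (br Y Z) X +
        (\<theta> Z X \<circ> br Y) + \<theta> (br Z X) Y = 0"
    using cocycle unfolding two_cocycle_def by blast
  from fun_cong[OF this, of W] show ?thesis by simp
qed

lemmas \<theta>_simps = bilinear_on_UNIV[OF \<theta>_bilinear]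

lemma \<psi>_br: "\<psi> (br X Y) F = \<psi> X (\<psi> Y F) - \<psi> Y (\<psi> X F)"
  and \<psi>_linear: "Vector_Spaces.linear scale_h scale_h (\<psi> X)"
  and \<psi>_linear_op: "Vector_Spaces.linear scale_g (fun_scale scale_h) \<psi>"
  using hom unfolding lie_hom_End_def by simp_all

lemmas \<psi>_simps = linear_simps[OF \<psi>_linear] linear_simps[OF \<psi>_linear_op]

lemma dual_simps:
  assumes "f \<in> dual_space scale_g"
  shows "f (x + y) = f x + f y" "f (scale_g c x) = c * f x" "f (x - y) = f x - f y"
    "f (- x) = - f x" "f 0 = 0"
  using linear_simps[of scale_g "(*)" f] assms by (simp_all add: dual_space_def)

text \<open>Polarisation: expand the vanishing bracket of \<open>X + Y\<close> with itself.\<close>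

lemma br_skew: "br Y X = - br X Y"
proof -
  have "br X Y + br Y X = br (X + Y) (X + Y)"
    unfolding br_simps(1,2) by (simp add: g.alternating)
  then show ?thesis by (simp add: g.alternating eq_neg_iff_add_eq_0 add.commute)
qed

text \<open>The Jacobi identity in the form that \<open>ad\<close> is a representation, oriented so
  that rewriting nests all brackets to the right.\<close>

lemma br_br: "br (br X Y) Z = br X (br Y Z) - br Y (br X Z)"
proof -
  have "br Y (br Z X) = - br Y (br X Z)" "br Z (br X Y) = - br (br X Y) Z"
    by (simp_all only: br_skew[of Z X] br_skew[of Z "br X Y"] br_simps minus_minus)
  then show ?thesis using g.jacobi[of X Y Z] by (simp add: algebra_simps)
qed

text \<open>Moving \<open>\<psi> Z\<close> across \<open>B_h\<close> and exchanging the arguments of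
  \<open>B_h\<close> each cost a sign, and the two signs cancel.\<close>

lemma \<phi>_sym: "\<phi> G F = \<phi> F G"
  by (rule ext) (metis \<phi>_apply \<psi>_skew h.skew)

section \<open>Closure and super identities of the bracket\<close>

lemma coad_apply [simp]: "coad br X f Y = - f (br X Y)"
  by (simp add: coad_def)

lemma bracket_dual:
  assumes "f \<in> dual_space scale_g" "g \<in> dual_space scale_g"
  shows "coad br X g - coad br Y f + \<theta> X Y + \<phi> F G \<in> dual_space scale_g"
  using assms \<theta>_dual[of X Y]
  by (simp add: dual_space_iff[OF vector_space_g] \<phi>_apply br_simps \<psi>_simps B_simps algebra_simps)

text \<open>Linearity of \<open>coad br X g\<close> in \<open>X\<close> rests on linearity of
  \<open>g\<close>; membership in \<open>ext_space\<close> supplies it.\<close>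

lemma ext_bracket_bilinear:
  "bilinear_on (ext_scale scale_g scale_h) (ext_scale scale_g scale_h) (ext_space scale_g)
    (ext_bracket br \<theta> \<psi> \<phi>)"
  unfolding bilinear_on_def ext_space_def
  by (auto simp: br_simps \<theta>_simps \<psi>_simps \<phi>_apply B_simps fun_eq_iff
      dual_simps algebra_simps)

lemma ext_bracket_graded:
  assumes "x \<in> parity_part i" "y \<in> parity_part j"
  shows "ext_bracket br \<theta> \<psi> \<phi> x y \<in> parity_part (i + j)"
proof -
  obtain X f F Y g G where xy: "x = (X, f, F)" "y = (Y, g, G)"
    by (cases x; cases y) auto
  \<comment> \<open>An odd element has middle component 0, so this puts the middle components in the
    dual for either parity.\<close>
  have "0 \<in> dual_space scale_g"
    by (simp add: dual_space_iff[OF vector_space_g])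
  then have "f \<in> dual_space scale_g" "g \<in> dual_space scale_g"
    using assms by (auto simp: xy ext_even_def ext_odd_def split: if_splits)
  then have "coad br X g - coad br Y f + \<theta> X Y + \<phi> F G \<in> dual_space scale_g"
    by (rule bracket_dual)
  then show ?thesis
    using assms unfolding xy
    by (cases i; cases j)
      (auto simp: ext_even_def ext_odd_def br_simps \<theta>_simps \<psi>_simps fun_eq_iff \<phi>_apply
        dual_simps B_simps)
qed

text \<open>The Koszul sign is -1 only for two odd elements, where symmetry of \<open>\<phi>\<close>
  is what is required. On even elements skewness of \<open>br\<close> and \<open>\<theta>\<close>
  suffices, since the two \<open>coad\<close> terms exchange.\<close>

lemma ext_bracket_super_skew:
  assumes "x \<in> parity_part i" "y \<in> parity_part j"
  shows "ext_bracket br \<theta> \<psi> \<phi> y x =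
    - ext_scale scale_g scale_h (koszul i j) (ext_bracket br \<theta> \<psi> \<phi> x y)"
proof -
  obtain X f F Y g G where xy: "x = (X, f, F)" "y = (Y, g, G)"
    by (cases x; cases y) auto
  have "br Y X = - br X Y" "\<theta> Y X = - \<theta> X Y" "\<phi> G F = \<phi> F G"
    by (fact br_skew \<theta>_skew \<phi>_sym)+
  then show ?thesis
    using assms unfolding xy
    by (cases i; cases j)
      (auto simp: koszul_def ext_even_def ext_odd_def br_simps \<theta>_simps \<psi>_simps fun_eq_iff
        \<phi>_apply dual_simps B_simps)
qed

lemma ext_bracket_super_jacobi:
  assumes "x \<in> parity_part i" "y \<in> parity_part j" "z \<in> parity_part k"
  shows "ext_bracket br \<theta> \<psi> \<phi> x (ext_bracket br \<theta> \<psi> \<phi> y z) =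
    ext_bracket br \<theta> \<psi> \<phi> (ext_bracket br \<theta> \<psi> \<phi> x y) z +
    ext_scale scale_g scale_h (koszul i j)
      (ext_bracket br \<theta> \<psi> \<phi> y (ext_bracket br \<theta> \<psi> \<phi> x z))"
proof -
  obtain X f F Y g G Z h H where xyz: "x = (X, f, F)" "y = (Y, g, G)" "z = (Z, h, H)"
    by (cases x; cases y; cases z) auto
  \<comment> \<open>The cocycle identity solved for the \<open>\<theta>\<close>-term that the
    left-hand side of the super Jacobi identity produces. \<open>X\<close>, \<open>Y\<close> and
    \<open>Z\<close> are fixed, so the rule does not apply to the \<open>\<theta>\<close>-terms on
    its right.\<close>
  have cocycle': "\<theta> X (br Y Z) W = \<theta> X Y (br Z W) - \<theta> X Z (br Y W) + \<theta> Y Z (br X W)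
      + \<theta> (br X Y) Z W + \<theta> Y (br X Z) W" for W
    using \<theta>_cocycle[of X Y Z W] \<theta>_skew[of Z X] \<theta>_skew[of X "br Y Z"]
      \<theta>_skew[of "br Z X" Y] br_skew[of X Z]
    by (simp add: \<theta>_simps algebra_simps)
  have move: "B_h F' (\<psi> W G') = - B_h (\<psi> W F') G'" for F' G' W
    by (simp add: \<psi>_skew)
  \<comment> \<open>Needed when \<open>x\<close> and \<open>y\<close> are odd and \<open>z\<close>
    is even: the bracket of \<open>y\<close> with that of \<open>x\<close> and \<open>z\<close>
    yields \<open>\<phi>\<close> with the roles of \<open>F\<close> and \<open>G\<close> exchanged.
    Fixing \<open>Z\<close>, \<open>F\<close> and \<open>G\<close> keeps the rule from rewriting its
    own result.\<close>
  have swap: "B_h (\<psi> W (\<psi> Z F)) G = - B_h (\<psi> Z (\<psi> W G)) F" for W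
  proof -
    have "B_h (\<psi> W (\<psi> Z F)) G = - B_h (\<psi> Z F) (\<psi> W G)"
      by (rule \<psi>_skew)
    also have "\<dots> = B_h (\<psi> W G) (\<psi> Z F)"
      by (rule h.skew[symmetric])
    also have "\<dots> = - B_h (\<psi> Z (\<psi> W G)) F"
      by (rule move)
    finally show ?thesis .
  qed
  show ?thesis
    using assms unfolding xyz
    by (cases i; cases j; cases k)
      (auto simp: koszul_def ext_even_def ext_odd_def br_simps br_br \<theta>_simps \<psi>_simps \<psi>_br
        fun_eq_iff \<phi>_apply dual_simps dual_simps[OF \<theta>_dual] B_simps cocycle'
        algebra_simps, simp_all add: move swap)
qed

section \<open>The grading and the Lie superalgebra structure\<close>

lemma ext_decomposition:
  "(ext_space scale_g :: ('g \<times> ('g \<Rightarrow> complex) \<times> 'h) set) =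
    {x + y | x y. x \<in> parity_part 0 \<and> y \<in> parity_part 1}"
  "parity_part 0 \<inter> parity_part 1 = {0 :: 'g \<times> ('g \<Rightarrow> complex) \<times> 'h}"
proof -
  show "(ext_space scale_g :: ('g \<times> ('g \<Rightarrow> complex) \<times> 'h) set) =
    {x + y | x y. x \<in> parity_part 0 \<and> y \<in> parity_part 1}"
  proof (intro set_eqI iffI)
    fix v :: "'g \<times> ('g \<Rightarrow> complex) \<times> 'h"
    assume "v \<in> ext_space scale_g"
    then obtain X f F where v: "v = (X, f, 0) + (0, 0, F)" "f \<in> dual_space scale_g"
      by (auto simp: ext_space_def)
    show "v \<in> {x + y | x y. x \<in> parity_part 0 \<and> y \<in> parity_part 1}"
      by (intro CollectI exI[of _ "(X, f, 0)"] exI[of _ "(0, 0, F)"])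
        (simp add: v ext_even_def ext_odd_def)
  qed (auto simp: ext_space_def ext_even_def ext_odd_def)
  show "parity_part 0 \<inter> parity_part 1 = {0 :: 'g \<times> ('g \<Rightarrow> complex) \<times> 'h}"
    by (auto simp: ext_even_def ext_odd_def zero_prod_def dual_space_iff[OF vector_space_g])
qed

lemma subspace_parity_part: "module.subspace (ext_scale scale_g scale_h) (parity_part i)"
  by (rule ve.subspaceI)
    (auto simp: ext_even_def ext_odd_def zero_prod_def dual_space_iff[OF vector_space_g]
      fun_eq_iff algebra_simps)

lemma lie_superalgebra_ext:
  "lie_superalgebra (ext_scale scale_g scale_h) (ext_space scale_g) parity_part
    (ext_bracket br \<theta> \<psi> \<phi>)"
  using fin_dim_subspace_ext_space[OF g.fin_dim h.fin_dim] subspace_parity_part ext_decomposition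
    ext_bracket_bilinear ext_bracket_graded ext_bracket_super_skew ext_bracket_super_jacobi
  by (rule lie_superalgebra.intro)

section \<open>The quadratic structure\<close>

lemma ext_form_bilinear:
  "bilinear_on (ext_scale scale_g scale_h) (*) (ext_space scale_g) (ext_form B_h)"
  unfolding bilinear_on_def ext_space_def
  by (auto simp: dual_simps B_simps algebra_simps)

text \<open>The form is the sum of the pairing of the Lie algebra with its dual and of
  \<open>B_h\<close>, so test vectors from a single summand isolate one component at a time.\<close>

lemma ext_form_nondegenerate: "nondegenerate_on (ext_space scale_g) (ext_form B_h)"
proof -
  have zero: "0 \<in> dual_space scale_g"
    by (simp add: dual_space_iff[OF vector_space_g])
  have B_left: "F = 0" if "\<And>G. B_h F G = 0" for F
    using h.nondegenerate that by (simp add: nondegenerate_on_def)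
  have left: "v = 0"
    if v_mem: "v \<in> ext_space scale_g" and orth: "\<forall>w\<in>ext_space scale_g. ext_form B_h v w = 0"
    for v :: "'g \<times> ('g \<Rightarrow> complex) \<times> 'h"
  proof -
    obtain X f F where v: "v = (X, f, F)" and f: "f \<in> dual_space scale_g"
      using v_mem by (auto simp: ext_space_def)
    have orth': "g X + f Y + B_h F G = 0" if "g \<in> dual_space scale_g" for Y g G
      using bspec[OF orth, of "(Y, g, G)"] that by (simp add: v ext_space_def add.commute)
    \<comment> \<open>With \<open>Y\<close> and \<open>G\<close> zero only the pairing of
      \<open>g\<close> with \<open>X\<close> survives, and functionals separate points.\<close>
    have "g X = 0" if "g \<in> dual_space scale_g" for g
      using orth'[OF that, of 0 0] f by (simp add: dual_simps B_simps)
    then have "X = 0"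
      using dual_space_separates[OF vector_space_g, of X] by blast
    moreover have "f = 0"
      using orth'[OF zero, of _ 0] by (auto simp: fun_eq_iff B_simps)
    moreover have "F = 0"
      using orth'[OF zero, of 0] f by (intro B_left) (simp add: dual_simps)
    ultimately show ?thesis by (simp add: v zero_prod_def)
  qed
  have right: "v = 0"
    if v: "v \<in> ext_space scale_g" and orth: "\<forall>w\<in>ext_space scale_g. ext_form B_h w v = 0"
    for v :: "'g \<times> ('g \<Rightarrow> complex) \<times> 'h"
  proof (rule left[OF v], rule ballI)
    fix w :: "'g \<times> ('g \<Rightarrow> complex) \<times> 'h"
    assume "w \<in> ext_space scale_g"
    \<comment> \<open>Negating the odd component of the test vector offsets the skewness of
      \<open>B_h\<close>, so the right radical reduces to the left one.\<close>
    then obtain Y g G where w: "w = (Y, g, G)" "(Y, g, - G) \<in> ext_space scale_g"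
      by (auto simp: ext_space_def)
    obtain X f F where "v = (X, f, F)" by (cases v) auto
    then have "ext_form B_h v w = ext_form B_h (Y, g, - G) v"
      using h.skew[of F G] by (simp add: w B_simps)
    then show "ext_form B_h v w = 0"
      using orth w(2) by simp
  qed
  show ?thesis
    unfolding nondegenerate_on_def using left right by blast
qed

lemma quadratic_lie_superalgebra_ext:
  assumes "cyclic \<theta>"
  shows "quadratic_lie_superalgebra (ext_scale scale_g scale_h) (ext_space scale_g) parity_part
    (ext_bracket br \<theta> \<psi> \<phi>) (ext_form B_h)"
proof -
  interpret lie_superalgebra "ext_scale scale_g scale_h" "ext_space scale_g" parity_part
    "ext_bracket br \<theta> \<psi> \<phi>"
    by (rule lie_superalgebra_ext)
  show ?thesis
  proof
    show "bilinear_on (ext_scale scale_g scale_h) (*) (ext_space scale_g) (ext_form B_h)"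
      by (rule ext_form_bilinear)
    show "nondegenerate_on (ext_space scale_g) (ext_form B_h)"
      by (rule ext_form_nondegenerate)
    show "ext_form B_h y x = koszul i j * ext_form B_h x y"
      if "x \<in> parity_part i" "y \<in> parity_part j" for x y i j
    proof -
      obtain X f F Y g G where xy: "x = (X, f, F)" "y = (Y, g, G)"
        by (cases x; cases y) auto
      show ?thesis
        \<comment> \<open>The pairing with the dual is symmetric, as even elements require; skewness
          of \<open>B_h\<close> gives the sign for two odd elements; mixed pairs vanish.\<close>
        using that h.skew[of F G] unfolding xy
        by (cases i; cases j)
          (auto simp: koszul_def ext_even_def ext_odd_def dual_simps B_simps)
    qed
    show "ext_form B_h (ext_bracket br \<theta> \<psi> \<phi> x y) z =
        ext_form B_h x (ext_bracket br \<theta> \<psi> \<phi> y z)"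
      if "x \<in> ext_space scale_g" "y \<in> ext_space scale_g" "z \<in> ext_space scale_g" for x y z
    proof -
      obtain X f F Y g G Z h H where xyz: "x = (X, f, F)" "y = (Y, g, G)" "z = (Z, h, H)"
        by (cases x; cases y; cases z) auto
      have "\<theta> X Y Z = \<theta> Y Z X"
        using assms unfolding cyclic_def by blast
      \<comment> \<open>Flipping two brackets matches the \<open>coad\<close> terms with the
        evaluations of functionals on brackets; \<open>\<psi>_skew\<close> turns the
        \<open>\<psi>\<close>-terms and \<open>\<phi>\<close>-terms of one side into those of the
        other.\<close>
      then show ?thesis
        using that br_skew[of X Y] br_skew[of X Z]
        by (simp add: xyz ext_space_def dual_simps B_simps \<phi>_apply \<psi>_skew)
    qed
    show "ext_form B_h x y = 0" if "x \<in> parity_part 0" "y \<in> parity_part 1" for x y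
      using that by (auto simp: ext_even_def ext_odd_def dual_simps B_simps)
  qed
qed

end

theorem proposition3p4:
  fixes scale_g :: "complex \<Rightarrow> 'g::ab_group_add \<Rightarrow> 'g"
    and br :: "'g \<Rightarrow> 'g \<Rightarrow> 'g"
    and \<theta> :: "'g \<Rightarrow> 'g \<Rightarrow> 'g \<Rightarrow> complex"
    and scale_h :: "complex \<Rightarrow> 'h::ab_group_add \<Rightarrow> 'h"
    and B_h :: "'h \<Rightarrow> 'h \<Rightarrow> complex"
    and \<psi> :: "'g \<Rightarrow> 'h \<Rightarrow> 'h"
    and \<phi> :: "'h \<Rightarrow> 'h \<Rightarrow> 'g \<Rightarrow> complex"
  assumes "lie_algebra scale_g br"
    and "two_cocycle scale_g br \<theta>"
    and "symplectic_space scale_h B_h"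
    and "lie_hom_End scale_g br scale_h \<psi>"
    and "\<And>X Y Z. B_h (\<psi> X Y) Z = - B_h Y (\<psi> X Z)"
    and "\<And>X Y Z. \<phi> X Y Z = B_h (\<psi> Z X) Y"
  shows "lie_superalgebra (ext_scale scale_g scale_h) (ext_space scale_g)
           (\<lambda>i. if i = 0 then ext_even scale_g else ext_odd) (ext_bracket br \<theta> \<psi> \<phi>) \<and>
         (cyclic \<theta> \<longrightarrow>
           quadratic_lie_superalgebra (ext_scale scale_g scale_h) (ext_space scale_g)
             (\<lambda>i. if i = 0 then ext_even scale_g else ext_odd) (ext_bracket br \<theta> \<psi> \<phi>)
             (ext_form B_h))"
proof -
  interpret ext_data scale_g br scale_h B_h \<theta> \<psi> \<phi>
    using assms by (intro ext_data.intro ext_data_axioms.intro)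
  show ?thesis
    using lie_superalgebra_ext quadratic_lie_superalgebra_ext by blast
qed

end
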